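(* Let $J\ge 1$ be an integer, and for $j=0,1,\dots,J-1$ set $\theta_j:=\frac{2j+1}{2J}\pi$. For every integer $k$ define $$f_{ss}(J,k):=\frac{1}{J}\sum_{j=0}^{J-1}\frac{\sin(k\theta_j)}{\sin\theta_j}.$$ Then $f_{ss}(J,k)$ is $4J$-periodic in $k$, i.e. $f_{ss}(J,k+4J)=f_{ss}(J,k)$ for all integers $k$, and $$f_{ss}(J,k)=\begin{cases}0, & k\ \text{even},\\ +1, & k\ \text{odd},\ 0<k<2J,\\ -1, & k\ \text{odd},\ 2J<k<4J.\end{cases}$$
   Context: $\mathbb{N}$ denotes the positive integers. *)

theory Defs
  imports Complex_Main
begin

definition theta :: "nat \<Rightarrow> nat \<Rightarrow> real" where
  "theta J j = (2 * real j + 1) / (2 * real J) * pi"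

definition f_ss :: "nat \<Rightarrow> int \<Rightarrow> real" where
  "f_ss J k = 1 / real J * (\<Sum>j = 0..<J. sin (of_int k * theta J j) / sin (theta J j))"

end

(* Shifting k by 2J changes k * theta_j by an odd multiple of pi, so f_ss changes sign; this gives
   the period 4J and the values for 2J < k < 4J. For even k the terms j and J - 1 - j cancel,
   because theta_(J-1-j) = pi - theta_j. For odd k, f_ss J (k + 2) - f_ss J k is a multiple of
   the sum of cos ((k + 1) * theta_j), which telescopes to 0 after multiplication by
   sin ((k + 1) * pi / (2J)), so f_ss J k = f_ss J 1 = 1 for odd k in (0, 2J). *)
theory Submission
  imports Defs
begin

text \<open>Each angle lies strictly between 0 and \<open>pi\<close>. This keeps the denominators in
  \<open>f_ss\<close> nonzero, so that they can be cancelled.\<close>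

lemma sin_theta_pos:
  assumes "j < J"
  shows "sin (theta J j) > 0"
proof (rule sin_gt_zero)
  show "theta J j > 0"
    using assms by (simp add: theta_def add_pos_nonneg)
  have "(2 * real j + 1) / (2 * real J) < 1"
    using assms by (simp add: field_simps)
  then show "theta J j < pi"
    unfolding theta_def using mult_strict_right_mono[OF _ pi_gt_zero] by fastforce
qed

lemma theta_reflect:
  assumes "j < J"
  shows "theta J (J - Suc j) = pi - theta J j"
  using assms by (simp add: theta_def of_nat_diff field_simps)

lemma sin_theta_shift:
  assumes "J \<ge> 1"
  shows "sin (of_int (k + 2 * int J) * theta J j) = - sin (of_int k * theta J j)"
proof -
  have "of_int (k + 2 * int J) * theta J j = of_int k * theta J j + real (2 * j + 1) * pi"
    using assms by (simp add: theta_def field_simps)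
  moreover have "sin (real (2 * j + 1) * pi) = 0" "cos (real (2 * j + 1) * pi) = - 1"
    by (simp_all only: sin_npi cos_npi) simp
  ultimately show ?thesis
    by (simp only: sin_add)
qed

lemma f_ss_shift:
  assumes "J \<ge> 1"
  shows "f_ss J (k + 2 * int J) = - f_ss J k"
  unfolding f_ss_def sin_theta_shift[OF assms] by (simp add: sum_negf)

lemma sin_even_reflect:
  assumes "even k"
  shows "sin (of_int k * (pi - x)) = - sin (of_int k * x)"
proof -
  from assms obtain m where "k = 2 * m" by blast
  \<comment> \<open>Evenness turns \<open>k * pi\<close> into a full number of turns, which drops
    out of the sine.\<close>
  then have "of_int k * (pi - x) = 2 * pi * of_int m - of_int k * x"
    by (simp add: algebra_simps)
  then show ?thesis
    by (simp only: sin_diff sin_int_2pin cos_int_2pin)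
qed

lemma f_ss_even:
  assumes "even k"
  shows "f_ss J k = 0"
proof -
  let ?g = "\<lambda>j. sin (of_int k * theta J j) / sin (theta J j)"
  have "(\<Sum>j<J. ?g j) = (\<Sum>j<J. ?g (J - Suc j))"
    by (rule sum.nat_diff_reindex [symmetric])
  \<comment> \<open>The reflection keeps each denominator and negates each numerator, so the sum
    equals its own negative.\<close>
  also have "\<dots> = (\<Sum>j<J. - ?g j)"
    by (rule sum.cong) (simp_all add: theta_reflect sin_even_reflect[OF assms])
  finally have "(\<Sum>j<J. ?g j) = 0"
    by (simp add: sum_negf)
  then show ?thesis
    by (simp add: f_ss_def atLeast0LessThan)
qed

text \<open>Each summand times \<open>2 * sin a\<close> is the difference of sines at
  \<open>(2 * j + 2) * a\<close> and \<open>2 * j * a\<close>.\<close>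

lemma sum_cos_odd_multiples: "2 * sin a * (\<Sum>j<n. cos ((2 * real j + 1) * a)) = sin (2 * real n * a)"
proof (induction n)
  case (Suc n)
  have "sin (2 * real (Suc n) * a) = sin ((2 * real n + 1) * a + a)"
    "sin (2 * real n * a) = sin ((2 * real n + 1) * a - a)"
    by (simp_all add: algebra_simps)
  then have "sin (2 * real (Suc n) * a) - sin (2 * real n * a) = 2 * sin a * cos ((2 * real n + 1) * a)"
    by (simp only: sin_add sin_diff) simp
  with Suc show ?case
    by (simp add: distrib_left)
qed simp

lemma sum_cos_theta:
  assumes "0 < n" "n < J"
  shows "(\<Sum>j<J. cos (2 * real n * theta J j)) = 0"
proof -
  \<comment> \<open>Chosen so that \<open>2 * n * theta J j\<close> is the odd multiple
    \<open>(2 * j + 1) * a\<close>; the bounds on \<open>n\<close> put \<open>a\<close> strictly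
    between 0 and \<open>pi\<close>, so \<open>sin a\<close> can be divided out.\<close>
  define a where "a = real n * pi / real J"
  have "2 * sin a * (\<Sum>j<J. cos ((2 * real j + 1) * a)) = sin (2 * real J * a)"
    by (rule sum_cos_odd_multiples)
  also have "2 * real J * a = real (2 * n) * pi"
    using assms by (simp add: a_def)
  also have "sin \<dots> = 0"
    by (rule sin_npi)
  finally have "2 * sin a * (\<Sum>j<J. cos ((2 * real j + 1) * a)) = 0" .
  moreover have "sin a > 0"
    using assms by (intro sin_gt_zero) (simp_all add: a_def field_simps)
  moreover have "2 * real n * theta J j = (2 * real j + 1) * a" for j
    using assms by (simp add: theta_def a_def field_simps)
  ultimately show ?thesis
    by simp
qed

lemma f_ss_odd:
  assumes "n < J"
  shows "f_ss J (2 * int n + 1) = 1"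
  using assms
proof (induction n)
  case 0
  have "(\<Sum>j<J. sin (theta J j) / sin (theta J j)) = (\<Sum>j<J. 1)"
    by (rule sum.cong) (use sin_theta_pos in force)+
  then show ?case
    using 0 by (simp add: f_ss_def atLeast0LessThan)
next
  case (Suc n)
  \<comment> \<open>Sum-to-product around the midpoint \<open>2 * (n + 1) * theta J j\<close>: the
    factor \<open>sin (theta J j)\<close> it produces cancels the denominator.\<close>
  have "sin (of_int (2 * int (Suc n) + 1) * theta J j) / sin (theta J j)
      = sin (of_int (2 * int n + 1) * theta J j) / sin (theta J j)
        + 2 * cos (2 * real (Suc n) * theta J j)" if "j < J" for j
  proof -
    let ?t = "theta J j"
    have "of_int (2 * int (Suc n) + 1) * ?t = 2 * real (Suc n) * ?t + ?t"
      "of_int (2 * int n + 1) * ?t = 2 * real (Suc n) * ?t - ?t"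
      by (simp_all add: algebra_simps)
    then have "sin (of_int (2 * int (Suc n) + 1) * ?t)
        = sin (of_int (2 * int n + 1) * ?t) + 2 * cos (2 * real (Suc n) * ?t) * sin ?t"
      by (simp only: sin_add sin_diff)
    then show ?thesis
      using sin_theta_pos[OF that] by (simp only: add_divide_distrib) simp
  qed
  then have "f_ss J (2 * int (Suc n) + 1)
      = f_ss J (2 * int n + 1) + 2 / real J * (\<Sum>j<J. cos (2 * real (Suc n) * theta J j))"
    unfolding f_ss_def atLeast0LessThan
    by (simp add: sum.distrib distrib_left sum_distrib_left[symmetric] del: of_nat_Suc of_int_add)
  also have "\<dots> = 1"
    using Suc sum_cos_theta[of "Suc n" J] by simp
  finally show ?case .
qed

theorem fact1:
  fixes J :: nat
  assumes "J \<ge> 1"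
  shows "(\<forall>k::int. f_ss J (k + 4 * int J) = f_ss J k) \<and>
    (\<forall>k::int. even k \<longrightarrow> f_ss J k = 0) \<and>
    (\<forall>k::int. odd k \<and> 0 < k \<and> k < 2 * int J \<longrightarrow> f_ss J k = 1) \<and>
    (\<forall>k::int. odd k \<and> 2 * int J < k \<and> k < 4 * int J \<longrightarrow> f_ss J k = -1)"
proof -
  have low: "f_ss J k = 1" if k: "odd k" "0 < k" "k < 2 * int J" for k
  proof -
    from k(1) obtain m where m: "k = 2 * m + 1" by (rule oddE)
    \<comment> \<open>Positivity of the odd \<open>k\<close> forces \<open>m \<ge> 0\<close>, so
      \<open>nat\<close> loses nothing.\<close>
    with k have "nat m < J" "int (nat m) = m" by linarith+
    with f_ss_odd[of "nat m" J] m show ?thesis by simp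
  qed
  have "f_ss J (k + 4 * int J) = f_ss J k" for k
    using f_ss_shift[OF assms, of "k + 2 * int J"] f_ss_shift[OF assms, of k]
    by (simp add: add.assoc)
  moreover have "f_ss J k = -1" if "odd k" "2 * int J < k" "k < 4 * int J" for k
    \<comment> \<open>Subtracting \<open>2 * J\<close> preserves parity and moves \<open>k\<close>
      into the range of \<open>low\<close>.\<close>
    using f_ss_shift[OF assms, of "k - 2 * int J"] low[of "k - 2 * int J"] that by simp
  ultimately show ?thesis
    using f_ss_even low by blast
qed

end
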